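(* Let $G=(V,E)$ be an undirected unweighted graph. Let $\pi$ be a replacement path tiebreaking scheme (RPTS) on $G$ selected by antisymmetric random reweighting. Then $\pi$ is simultaneously stable, consistent, and restorable.
   Context: A shortest path tiebreaking scheme on a graph maps each ordered vertex pair $(s,t)$ to one particular shortest $s \leadsto t$ path (or $\emptyset$ if none exists). A replacement path tiebreaking scheme (RPTS) on $G=(V,E)$ is a function $\pi(s,t\mid F)$, for $s,t\in V$ and $F\subseteq E$, such that for each fixed $F$ the function $\pi(\cdot,\cdot\mid F)$ is a shortest path tiebreaking scheme in $G\setminus F$; write $\pi(s,t)=\pi(s,t\mid\emptyset)$. $\pi$ is consistent if for every $F$ and all vertices $s,t,u,v$, whenever $u$ precedes $v$ on $\pi(s,t\mid F)$, the path $\pi(u,v\mid F)$ is a contiguous subpath of $\pi(s,t\mid F)$. $\pi$ is stable if for all $s,t,F$ and every edge $f\notin \pi(s,t\mid F)$ we have $\pi(s,t\mid F)=\pi(s,t\mid F\cup\{f\})$. $\pi$ is restorable if for all vertices $s,t$ and every nonempty $F\subseteq E$ there exist a vertex $x$ and a proper subset $F'\subsetneq F$ such that the concatenation of $\pi(s,x\mid F')$ and (the reverse of) $\pi(t,x\mid F')$ is a shortest $s\leadsto t$ path in $G\setminus F$ (it need not equal $\pi(s,t\mid F)$). Antisymmetric random reweighting: replace every undirected edge $\{u,v\}$ by the two directed edges $(u,v),(v,u)$; for each such pair choose $r(u,v)$ uniformly at random from $[-\varepsilon,\varepsilon]$ and set $r(v,u)=-r(u,v)$; give $(u,v)$ weight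 $1+r(u,v)$ and $(v,u)$ weight $1+r(v,u)$. Here $\varepsilon>0$ is small enough that every shortest path in the reweighted graph is a shortest path in the unweighted graph; with probability 1 the reweighted graph has unique shortest paths (also after deleting any edge set). The RPTS selected is $\pi(s,t\mid F)=$ the unique shortest directed $s\leadsto t$ path in the reweighted directed graph with (both orientations of) the edges of $F$ removed.
   Formalization: The graph is finite and simple, the conclusion holds with probability 1, and restorability is claimed only for pairs s, t that remain connected in G∖F, since otherwise no shortest s–t path in G∖F exists. *)

theory Defs
  imports
    "HOL-Probability.Probability"
    "HOL-Library.Sublist"
    "Graph_Theory.Graph_Theory"
begin

definition undirected_graph :: "'a set \<Rightarrow> 'a set set \<Rightarrow> bool" where
  "undirected_graph V E \<longleftrightarrow>
     finite V \<and> (\<forall>e\<in>E. \<exists>u\<in>V. \<exists>v\<in>V. u \<noteq> v \<and> e = {u, v})"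

definition bidirect :: "'a set \<Rightarrow> 'a set set \<Rightarrow> 'a pair_pre_digraph" where
  "bidirect V E = \<lparr>pverts = V, parcs = {(u, v). {u, v} \<in> E}\<rparr>"

text \<open>A path is its list of vertices, so the trivial path at \<open>s\<close> is \<open>[s]\<close>. The paths of an
  undirected graph are the paths of its bidirected version. Deleting an edge set \<open>F\<close> from
  \<open>(V, E)\<close> gives \<open>(V, E - F)\<close>.\<close>

definition is_path :: "'a set \<Rightarrow> 'a set set \<Rightarrow> 'a \<Rightarrow> 'a \<Rightarrow> 'a list \<Rightarrow> bool" where
  "is_path V E s t p \<longleftrightarrow> vpath p (with_proj (bidirect V E)) \<and> hd p = s \<and> last p = t"

definition path_edges :: "'a list \<Rightarrow> 'a set set" where
  "path_edges p = (\<lambda>(u, v). {u, v}) ` set (vwalk_arcs p)"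

definition path_weight :: "('a \<times> 'a \<Rightarrow> real) \<Rightarrow> 'a list \<Rightarrow> real" where
  "path_weight w p = (\<Sum>a\<leftarrow>vwalk_arcs p. w a)"

definition shortest_path ::
    "'a set \<Rightarrow> 'a set set \<Rightarrow> ('a \<times> 'a \<Rightarrow> real) \<Rightarrow> 'a \<Rightarrow> 'a \<Rightarrow> 'a list \<Rightarrow> bool" where
  "shortest_path V E w s t p \<longleftrightarrow>
     is_path V E s t p \<and> (\<forall>q. is_path V E s t q \<longrightarrow> path_weight w p \<le> path_weight w q)"

abbreviation unweighted_shortest_path ::
    "'a set \<Rightarrow> 'a set set \<Rightarrow> 'a \<Rightarrow> 'a \<Rightarrow> 'a list \<Rightarrow> bool" where
  "unweighted_shortest_path V E \<equiv> shortest_path V E (\<lambda>_. 1)"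


section \<open>Replacement path tiebreaking schemes\<close>

text \<open>The value \<open>None\<close> says that there is no path. Values outside \<open>V\<close>, or for \<open>F\<close> not a subset
  of \<open>E\<close>, are irrelevant.\<close>

type_synonym 'a scheme = "'a \<Rightarrow> 'a \<Rightarrow> 'a set set \<Rightarrow> 'a list option"

definition tiebreaking_scheme ::
    "'a set \<Rightarrow> 'a set set \<Rightarrow> ('a \<Rightarrow> 'a \<Rightarrow> 'a list option) \<Rightarrow> bool" where
  "tiebreaking_scheme V E \<tau> \<longleftrightarrow>
     (\<forall>s\<in>V. \<forall>t\<in>V. case \<tau> s t of
        None \<Rightarrow> \<not> (\<exists>p. is_path V E s t p)
      | Some p \<Rightarrow> unweighted_shortest_path V E s t p)"

definition rpts :: "'a set \<Rightarrow> 'a set set \<Rightarrow> 'a scheme \<Rightarrow> bool" where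
  "rpts V E \<pi> \<longleftrightarrow> (\<forall>F\<subseteq>E. tiebreaking_scheme V (E - F) (\<lambda>s t. \<pi> s t F))"

definition precedes :: "'a \<Rightarrow> 'a \<Rightarrow> 'a list \<Rightarrow> bool" where
  "precedes u v p \<longleftrightarrow> (\<exists>i j. i < j \<and> j < length p \<and> p ! i = u \<and> p ! j = v)"

definition consistent :: "'a set \<Rightarrow> 'a set set \<Rightarrow> 'a scheme \<Rightarrow> bool" where
  "consistent V E \<pi> \<longleftrightarrow>
     (\<forall>F\<subseteq>E. \<forall>s\<in>V. \<forall>t\<in>V. \<forall>u\<in>V. \<forall>v\<in>V. \<forall>p. \<pi> s t F = Some p \<and> precedes u v p \<longrightarrow>
        (\<exists>q. \<pi> u v F = Some q \<and> sublist q p))"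

definition stable :: "'a set \<Rightarrow> 'a set set \<Rightarrow> 'a scheme \<Rightarrow> bool" where
  "stable V E \<pi> \<longleftrightarrow>
     (\<forall>F\<subseteq>E. \<forall>s\<in>V. \<forall>t\<in>V. \<forall>f\<in>E.
        (\<forall>p. \<pi> s t F = Some p \<longrightarrow> f \<notin> path_edges p) \<longrightarrow> \<pi> s t F = \<pi> s t (F \<union> {f}))"

text \<open>Restorability can only be asked of pairs \<open>s\<close>, \<open>t\<close> that the deletion of \<open>F\<close> leaves
  connected, since otherwise there is no shortest path to be restored. The list
  \<open>p @ tl (rev q)\<close> is the concatenation of \<open>p\<close>, ending at \<open>x\<close>, with the reverse of \<open>q\<close>,
  starting at \<open>x\<close>.\<close>

definition restorable :: "'a set \<Rightarrow> 'a set set \<Rightarrow> 'a scheme \<Rightarrow> bool" where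
  "restorable V E \<pi> \<longleftrightarrow>
     (\<forall>s\<in>V. \<forall>t\<in>V. \<forall>F\<subseteq>E. F \<noteq> {} \<and> (\<exists>p. is_path V (E - F) s t p) \<longrightarrow>
        (\<exists>x\<in>V. \<exists>F'. F' \<subset> F \<and>
           (\<exists>p q. \<pi> s x F' = Some p \<and> \<pi> t x F' = Some q \<and>
                  unweighted_shortest_path V (E - F) s t (p @ tl (rev q)))))"


section \<open>Antisymmetric random reweighting\<close>

definition antisymmetric_on :: "'a set set \<Rightarrow> ('a \<times> 'a \<Rightarrow> real) \<Rightarrow> bool" where
  "antisymmetric_on E \<rho> \<longleftrightarrow> (\<forall>u v. {u, v} \<in> E \<longrightarrow> \<rho> (v, u) = - \<rho> (u, v))"

definition reweight :: "('a \<times> 'a \<Rightarrow> real) \<Rightarrow> 'a \<times> 'a \<Rightarrow> real" where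
  "reweight \<rho> a = 1 + \<rho> a"

text \<open>The bound \<open>\<epsilon>\<close> is small enough: whatever perturbation is drawn from \<open>[-\<epsilon>, \<epsilon>]\<close>, and whatever
  edges are deleted, reweighted shortest paths are unweighted shortest paths.\<close>

definition small_perturbation :: "'a set \<Rightarrow> 'a set set \<Rightarrow> real \<Rightarrow> bool" where
  "small_perturbation V E \<epsilon> \<longleftrightarrow>
     (\<forall>\<rho>. antisymmetric_on E \<rho> \<and> (\<forall>u v. {u, v} \<in> E \<longrightarrow> \<bar>\<rho> (u, v)\<bar> \<le> \<epsilon>) \<longrightarrow>
        (\<forall>F\<subseteq>E. \<forall>s t p. shortest_path V (E - F) (reweight \<rho>) s t p \<longrightarrow>
                          unweighted_shortest_path V (E - F) s t p))"

text \<open>An orientation selects, for every edge, the one of its two arcs whose perturbation is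
  drawn; the perturbation of the other arc is then determined by antisymmetry.\<close>

definition orientation :: "'a set set \<Rightarrow> ('a \<times> 'a) set \<Rightarrow> bool" where
  "orientation E D \<longleftrightarrow>
     (\<forall>(u, v)\<in>D. {u, v} \<in> E) \<and> (\<forall>u v. {u, v} \<in> E \<longrightarrow> ((u, v) \<in> D \<longleftrightarrow> (v, u) \<notin> D))"

definition antisymmetric_random_perturbation ::
    "'a set set \<Rightarrow> real \<Rightarrow> 'w measure \<Rightarrow> ('w \<Rightarrow> 'a \<times> 'a \<Rightarrow> real) \<Rightarrow> bool" where
  "antisymmetric_random_perturbation E \<epsilon> M r \<longleftrightarrow>
     prob_space M \<and>
     (\<forall>\<omega>\<in>space M. antisymmetric_on E (r \<omega>)) \<and>
     (\<exists>D. orientation E D \<and>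
        prob_space.indep_vars M (\<lambda>_. borel) (\<lambda>a \<omega>. r \<omega> a) D \<and>
        (\<forall>a\<in>D. distributed M lborel (\<lambda>\<omega>. r \<omega> a)
                  (\<lambda>x. indicator {-\<epsilon>..\<epsilon>} x / measure lborel {-\<epsilon>..\<epsilon>})))"

definition selected_by ::
    "'a set \<Rightarrow> 'a set set \<Rightarrow> ('a \<times> 'a \<Rightarrow> real) \<Rightarrow> 'a scheme \<Rightarrow> bool" where
  "selected_by V E w \<pi> \<longleftrightarrow>
     (\<forall>F\<subseteq>E. \<forall>s\<in>V. \<forall>t\<in>V. case \<pi> s t F of
        None \<Rightarrow> \<not> (\<exists>p. is_path V (E - F) s t p)
      | Some p \<Rightarrow> shortest_path V (E - F) w s t p \<and>
                  (\<forall>q. shortest_path V (E - F) w s t q \<longrightarrow> q = p))"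

lemma small_perturbation_if_bound:
  assumes G: "undirected_graph V E" and eps: "0 \<le> \<epsilon>" "2 * \<epsilon> * real (card V) < 1"
  shows "small_perturbation V E \<epsilon>"
  unfolding small_perturbation_def
proof (intro allI impI)
  fix \<rho> F s t p
  assume \<rho>: "antisymmetric_on E \<rho> \<and> (\<forall>u v. {u, v} \<in> E \<longrightarrow> \<bar>\<rho> (u, v)\<bar> \<le> \<epsilon>)"
    and F: "F \<subseteq> E" and p: "shortest_path V (E - F) (reweight \<rho>) s t p"
  define len where "len q = real (length (vwalk_arcs q))" for q :: "'a list"
  have unw: "path_weight (\<lambda>_. 1) q = len q" for q :: "'a list"
    by (simp add: path_weight_def len_def sum_list_triv)
  have dev: "\<bar>path_weight (reweight \<rho>) q - len q\<bar> \<le> \<epsilon> * len q \<and> len q \<le> card V"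
    if q: "is_path V (E - F) s t q" for q
  proof
    have arcs: "\<bar>\<rho> a\<bar> \<le> \<epsilon>" if "a \<in> set (vwalk_arcs q)" for a
      using that q \<rho>
      by (cases a) (auto simp: is_path_def vpath_def vwalk_def bidirect_def with_proj_def
                               arcs_ends_def arc_to_ends_def)
    have sum: "\<bar>(\<Sum>a\<leftarrow>xs. reweight \<rho> a) - real (length xs)\<bar> \<le> \<epsilon> * real (length xs)"
      if "\<forall>a\<in>set xs. \<bar>\<rho> a\<bar> \<le> \<epsilon>" for xs
      using that by (induction xs) (auto simp: reweight_def algebra_simps abs_le_iff)
    show "\<bar>path_weight (reweight \<rho>) q - len q\<bar> \<le> \<epsilon> * len q"
      using sum[of "vwalk_arcs q"] arcs by (auto simp: path_weight_def len_def)
    have "distinct q" "set q \<subseteq> V"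
      using q by (auto simp: is_path_def vpath_def vwalk_def bidirect_def with_proj_def)
    then have "length q \<le> card V"
      using G by (metis card_mono distinct_card undirected_graph_def)
    moreover have "length (vwalk_arcs q) = length q - 1"
      using vwalk_length_simp[of q] unfolding vwalk_length_def .
    ultimately show "len q \<le> card V"
      by (simp add: len_def)
  qed
  have "len p \<le> len q" if q: "is_path V (E - F) s t q" for q
  proof (rule ccontr)
    assume "\<not> len p \<le> len q"
    then have 1: "len q + 1 \<le> len p" by (simp add: len_def)
    have pp: "is_path V (E - F) s t p"
      and 2: "path_weight (reweight \<rho>) p \<le> path_weight (reweight \<rho>) q"
      using p q by (auto simp: shortest_path_def)
    have "\<epsilon> * len p \<le> \<epsilon> * card V" "\<epsilon> * len q \<le> \<epsilon> * card V"
      using dev[OF pp] dev[OF q] eps by (auto intro: mult_left_mono)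
    then show False using 1 2 dev[OF pp] dev[OF q] eps by linarith
  qed
  then show "unweighted_shortest_path V (E - F) s t p"
    using p by (simp add: shortest_path_def unw)
qed

end

theory Submission
  imports Defs
begin

text \<open>Almost surely no two distinct paths with the same endpoints have equal weight: they diverge at
  an edge whose net coefficient in the difference of the two weights is nonzero, and the
  perturbation of that edge is atomless and independent of all others.

  Given uniqueness, stability and consistency are exchange arguments. For restorability it suffices
  to treat a single failing edge \<open>e\<close>. On a shortest path avoiding \<open>e\<close>, let \<open>y\<close>
  be the first vertex with \<open>e \<in> \<pi>(s, y)\<close> and \<open>x\<close> its predecessor. If \<open>\<pi>(t, x)\<close> also used \<open>e\<close>, it would do so in
  the opposite direction, and exchanging tails of \<open>\<pi>(s, y)\<close> and \<open>\<pi>(t, x)\<close> would replace both arcs of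
  \<open>e\<close> by both arcs of \<open>{x, y}\<close>; by antisymmetry this leaves the total weight unchanged, which
  contradicts uniqueness of \<open>\<pi>(s, y)\<close>.\<close>

section \<open>Walks\<close>

text \<open>Vertices may repeat, so concatenations and swapped tails stay in this class. Membership
  in \<open>E\<close> goes through \<open>path_edges\<close>, which turns the deletion of an edge
  into plain set difference.\<close>

definition is_walk :: "'a set \<Rightarrow> 'a set set \<Rightarrow> 'a \<Rightarrow> 'a \<Rightarrow> 'a list \<Rightarrow> bool" where
  "is_walk V E s t p \<longleftrightarrow> p \<noteq> [] \<and> set p \<subseteq> V \<and> path_edges p \<subseteq> E \<and> hd p = s \<and> last p = t"

abbreviation hops :: "'a list \<Rightarrow> real" where
  "hops \<equiv> path_weight (\<lambda>_. 1)"

lemma arcs_ends_bidirect: "arcs_ends (with_proj (bidirect V E)) = {(u, v). {u, v} \<in> E}"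
  by (auto simp: bidirect_def with_proj_def arcs_ends_def arc_to_ends_def)

lemma is_path_iff: "is_path V E s t p \<longleftrightarrow> is_walk V E s t p \<and> distinct p"
  unfolding is_path_def vpath_def vwalk_def is_walk_def arcs_ends_bidirect path_edges_def
  by (auto simp: bidirect_def with_proj_def)

lemma is_pathD:
  assumes "is_path V E s t p"
  shows "is_walk V E s t p" "distinct p"
  using assms by (simp_all add: is_path_iff)

text \<open>The cut vertex \<open>x\<close> is kept on both sides, so no arc is lost. Every later
  splitting of weights, edges and walks rests on this form.\<close>

lemma vwalk_arcs_join: "vwalk_arcs (p @ x # q) = vwalk_arcs (p @ [x]) @ vwalk_arcs (x # q)"
  by (cases "p = []"; cases q) (simp_all add: vwalk_arcs_append)

lemma path_weight_join:
  "path_weight w (p @ x # q) = path_weight w (p @ [x]) + path_weight w (x # q)"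
  unfolding path_weight_def by (subst vwalk_arcs_join) simp

lemma path_edges_join: "path_edges (p @ x # q) = path_edges (p @ [x]) \<union> path_edges (x # q)"
  unfolding path_edges_def by (subst vwalk_arcs_join) auto

lemma path_weight_simps [simp]:
  "path_weight w [x] = 0"
  "path_weight w (x # y # p) = w (x, y) + path_weight w (y # p)"
  by (simp_all add: path_weight_def)

lemma path_edges_simps [simp]:
  "path_edges [x] = {}"
  "path_edges (x # y # p) = insert {x, y} (path_edges (y # p))"
  by (auto simp: path_edges_def)

lemma is_walk_join_iff:
  "is_walk V E s t (p @ x # q) \<longleftrightarrow> is_walk V E s x (p @ [x]) \<and> is_walk V E x t (x # q)"
  unfolding is_walk_def by (subst path_edges_join) (cases p; auto)

lemma is_walk_snoc_iff:
  assumes "p \<noteq> []"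
  shows "is_walk V E s t (p @ [y]) \<longleftrightarrow> is_walk V E s (last p) p \<and> {last p, y} \<in> E \<and> y \<in> V \<and> y = t"
  using assms
proof (cases p rule: rev_cases)
  case (snoc xs x)
  then show ?thesis
    using is_walk_join_iff[of V E s t xs x "[y]"] by (auto simp: is_walk_def)
qed simp

lemma path_weight_snoc:
  assumes "p \<noteq> []"
  shows "path_weight w (p @ [y]) = path_weight w p + w (last p, y)"
  using assms
proof (cases p rule: rev_cases)
  case (snoc xs x)
  then show ?thesis
    using path_weight_join[of w xs x "[y]"] by simp
qed simp

lemma path_edges_snoc:
  assumes "p \<noteq> []"
  shows "path_edges (p @ [y]) = insert {last p, y} (path_edges p)"
  using assms
proof (cases p rule: rev_cases)
  case (snoc xs x)
  then show ?thesis
    using path_edges_join[of xs x "[y]"] by simp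
qed simp

lemma walk_concat:
  assumes "is_walk V E s x p" "is_walk V E x t q"
  shows "is_walk V E s t (p @ tl q)"
    and "path_weight w (p @ tl q) = path_weight w p + path_weight w q"
proof -
  obtain p' where p: "p = p' @ [x]"
    using assms(1) by (cases p rule: rev_cases) (auto simp: is_walk_def)
  obtain q' where q: "q = x # q'"
    using assms(2) by (cases q) (auto simp: is_walk_def)
  show "is_walk V E s t (p @ tl q)"
    "path_weight w (p @ tl q) = path_weight w p + path_weight w q"
    using assms is_walk_join_iff[of V E s t p' x q'] path_weight_join[of w p' x q']
    by (simp_all add: p q)
qed

lemma path_edges_rev: "path_edges (rev p) = path_edges p"
  unfolding path_edges_def set_vwalk_arcs_rev by (force simp: insert_commute)

lemma hops_eq: "hops p = real (length p - 1)"
  using vwalk_length_simp[of p] by (simp add: path_weight_def sum_list_triv vwalk_length_def del: vwalk_length_simp)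

lemma hops_rev: "hops (rev p) = hops p"
  by (simp add: hops_eq)

lemma is_walk_rev: "is_walk V E s t p \<Longrightarrow> is_walk V E t s (rev p)"
  by (auto simp: is_walk_def path_edges_rev hd_rev last_rev)

lemma is_walk_avoid: "is_walk V E s t p \<Longrightarrow> e \<notin> path_edges p \<Longrightarrow> is_walk V (E - {e}) s t p"
  by (auto simp: is_walk_def)

lemma is_path_avoid: "is_path V E s t p \<Longrightarrow> e \<notin> path_edges p \<Longrightarrow> is_path V (E - {e}) s t p"
  by (simp add: is_path_iff is_walk_avoid)

lemma is_path_mono: "is_path V E s t p \<Longrightarrow> E \<subseteq> E' \<Longrightarrow> is_path V E' s t p"
  by (auto simp: is_path_iff is_walk_def)

text \<open>Cutting out the closed detour between two occurrences of a vertex saves at least one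
  hop. The strict clause is what forces hop-minimal walks to be paths.\<close>

lemma walk_imp_path:
  assumes "is_walk V E s t p"
  shows "\<exists>q. is_path V E s t q \<and> hops q \<le> hops p \<and> (\<not> distinct p \<longrightarrow> hops q < hops p)"
  using assms
proof (induction "length p" arbitrary: p rule: less_induct)
  case less
  show ?case
  proof (cases "distinct p")
    case True
    then show ?thesis using less.prems by (auto simp: is_path_iff)
  next
    case False
    then obtain xs y ys zs where p: "p = xs @ y # ys @ y # zs"
      using not_distinct_decomp[of p] by auto
    let ?q = "xs @ y # zs"
    have "is_walk V E s y (xs @ [y])" "is_walk V E y t (y # zs)"
      using less.prems p is_walk_join_iff[of V E s t xs y "ys @ y # zs"]
        is_walk_join_iff[of V E y t "y # ys" y zs] by auto
    then have "is_walk V E s t ?q"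
      using is_walk_join_iff[of V E s t xs y zs] by blast
    moreover have "length ?q < length p" "hops ?q < hops p"
      by (auto simp: p hops_eq)
    ultimately show ?thesis
      using less.hyps[of ?q] by fastforce
  qed
qed

lemma short_walk:
  assumes "is_walk V E s t p" and "\<And>q. is_path V E s t q \<Longrightarrow> hops p \<le> hops q"
  shows "unweighted_shortest_path V E s t p"
  using walk_imp_path[OF assms(1)] assms by (fastforce simp: shortest_path_def is_path_iff)

lemma unweighted_shortest_path_le_walk:
  assumes "unweighted_shortest_path V E s t p" "is_walk V E s t q"
  shows "hops p \<le> hops q"
  using walk_imp_path[OF assms(2)] assms(1) by (fastforce simp: shortest_path_def)

lemma finite_paths:
  assumes "finite V"
  shows "finite {p. is_path V E s t p}"
  by (rule finite_subset[OF _ finite_subset_distinct[OF assms]]) (auto simp: is_path_iff is_walk_def)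

lemma ex_shortest_path:
  assumes "finite V" "is_path V E s t p"
  shows "\<exists>q. shortest_path V E w s t q"
proof -
  let ?S = "{p. is_path V E s t p}"
  have "arg_min_on (path_weight w) ?S \<in> ?S"
    using assms finite_paths by (intro arg_min_if_finite) auto
  then show ?thesis
    using assms(2) finite_paths[OF assms(1)] arg_min_least[of ?S _ "path_weight w"]
    unfolding shortest_path_def by blast
qed

section \<open>Locating an edge on a path\<close>

lemma in_vwalk_arcsD: "(u, v) \<in> set (vwalk_arcs p) \<Longrightarrow> \<exists>xs ys. p = xs @ u # v # ys"
proof (induction p rule: vwalk_arcs.induct)
  case (3 x y xs)
  show ?case
  proof (cases "(u, v) = (x, y)")
    case True
    then have "x # y # xs = [] @ u # v # xs" by simp
    then show ?thesis by blast
  next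
    case False
    then obtain as bs where "y # xs = as @ u # v # bs"
      using 3 by auto
    then have "x # y # xs = (x # as) @ u # v # bs" by simp
    then show ?thesis by blast
  qed
qed auto

lemma path_edge_cases:
  assumes "e \<in> path_edges p"
  obtains xs u v ys where "p = xs @ u # v # ys" "e = {u, v}"
proof -
  obtain u v where "(u, v) \<in> set (vwalk_arcs p)" "e = {u, v}"
    using assms by (auto simp: path_edges_def)
  then show thesis using that in_vwalk_arcsD by metis
qed

lemma list_first_failure:
  assumes "p \<noteq> []" "P (hd p)" "\<not> P (last p)"
  shows "\<exists>xs x y ys. p = xs @ x # y # ys \<and> P x \<and> \<not> P y"
  using assms
proof (induction p rule: induct_list012)
  case (3 x y zs)
  show ?case
  proof (cases "P y")
    case True
    then obtain xs x' y' ys where "y # zs = xs @ x' # y' # ys" "P x'" "\<not> P y'"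
      using 3 by auto
    then have "x # y # zs = (x # xs) @ x' # y' # ys" by simp
    with \<open>P x'\<close> \<open>\<not> P y'\<close> show ?thesis by blast
  next
    case False
    moreover have "x # y # zs = [] @ x # y # zs" "P x"
      using 3 by simp_all
    ultimately show ?thesis by blast
  qed
qed auto


section \<open>Weights that break ties between shortest paths\<close>

text \<open>The deterministic hypotheses for a single edge set, later instantiated with
  \<open>E - F\<close> for every \<open>F\<close>. The condition \<open>both_directions\<close> is
  antisymmetry of the perturbation, with the 1 of each arc added.\<close>

locale tiebreaking_weight =
  fixes V :: "'a set" and E :: "'a set set" and w :: "'a \<times> 'a \<Rightarrow> real"
  assumes finite_V: "finite V"
    and both_directions: "{u, v} \<in> E \<Longrightarrow> w (u, v) + w (v, u) = 2"
    and refines: "shortest_path V E w s t p \<Longrightarrow> unweighted_shortest_path V E s t p"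
    and unique: "shortest_path V E w s t p \<Longrightarrow> shortest_path V E w s t q \<Longrightarrow> p = q"
begin

lemma ex_shortest:
  assumes "is_walk V E s t p"
  shows "\<exists>q. shortest_path V E w s t q"
  using walk_imp_path[OF assms] ex_shortest_path[OF finite_V] by blast

lemma is_walk_if_shortest: "shortest_path V E w s t p \<Longrightarrow> is_walk V E s t p"
  by (simp add: shortest_path_def is_path_iff)

lemma hops_le_walk:
  "shortest_path V E w s t p \<Longrightarrow> is_walk V E s t q \<Longrightarrow> hops p \<le> hops q"
  using refines unweighted_shortest_path_le_walk by metis

text \<open>Arc weights may be negative, so a walk can be compared with the shortest path only when it
  has no more hops, which forces it to be a path.\<close>

lemma weight_le_walk:
  assumes p: "shortest_path V E w s t p" and q: "is_walk V E s t q" "hops q \<le> hops p"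
  shows "path_weight w p \<le> path_weight w q"
    and "path_weight w q \<le> path_weight w p \<Longrightarrow> q = p"
proof -
  have "unweighted_shortest_path V E s t q"
    using p q hops_le_walk by (intro short_walk) (auto simp: is_path_iff intro: order_trans)
  then have path: "is_path V E s t q"
    by (simp add: shortest_path_def)
  then show "path_weight w p \<le> path_weight w q"
    using p by (simp add: shortest_path_def)
  assume "path_weight w q \<le> path_weight w p"
  then have "shortest_path V E w s t q"
    using p path by (force simp: shortest_path_def)
  then show "q = p" using p unique by blast
qed

text \<open>A better path from \<open>u\<close> to \<open>v\<close> could be spliced into the given
  one. The splice may repeat vertices, so it has to be judged by
  \<open>weight_le_walk\<close>.\<close>

lemma shortest_subpath:
  assumes "shortest_path V E w s t (xs @ u # ys @ v # zs)"
  shows "shortest_path V E w u v (u # ys @ [v])"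
proof -
  let ?p = "xs @ u # ys @ v # zs" and ?m = "u # ys @ [v]"
  have p: "is_walk V E s t ?p" "distinct ?p"
    using assms by (auto simp: shortest_path_def is_path_iff)
  then have walks: "is_walk V E s u (xs @ [u])" "is_walk V E u v ?m" "is_walk V E v t (v # zs)"
    using is_walk_join_iff[of V E s t xs u "ys @ v # zs"] is_walk_join_iff[of V E u t "u # ys" v zs]
    by auto
  have split: "path_weight w' ?p
      = path_weight w' (xs @ [u]) + path_weight w' ?m + path_weight w' (v # zs)" for w'
    using path_weight_join[of w' xs u "ys @ v # zs"] path_weight_join[of w' "u # ys" v zs] by simp
  obtain q where q: "shortest_path V E w u v q"
    using walks(2) ex_shortest by blast
  note q_walk = is_walk_if_shortest[OF q]
  let ?r = "(xs @ [u]) @ tl q"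
  have r: "is_walk V E s v ?r"
    "path_weight w' ?r = path_weight w' (xs @ [u]) + path_weight w' q" for w'
    using walk_concat[OF walks(1) q_walk] by auto
  note rz = walk_concat[OF r(1) walks(3)]
  \<comment> \<open>This supplies the hop condition of \<open>weight_le_walk\<close> for the spliced
    walk.\<close>
  have "hops q \<le> hops ?m"
    using q walks(2) hops_le_walk by blast
  then have "hops (?r @ tl (v # zs)) \<le> hops ?p"
    unfolding rz(2) r(2) split by simp
  then have "path_weight w ?p \<le> path_weight w (?r @ tl (v # zs))"
    using weight_le_walk(1)[OF assms rz(1)] by blast
  then have "path_weight w ?m \<le> path_weight w q"
    unfolding rz(2) r(2) split by simp
  moreover have "is_path V E u v ?m"
    using walks(2) p(2) by (auto simp: is_path_iff)
  ultimately show ?thesis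
    using q by (force simp: shortest_path_def)
qed

lemma shortest_trivial: "t \<in> V \<Longrightarrow> shortest_path V E w t t [t]"
proof -
  assume "t \<in> V"
  moreover have "q = [t]" if "is_path V E t t q" for q
    using that by (cases q; cases "tl q") (auto simp: is_path_iff is_walk_def split: if_splits)
  ultimately show ?thesis
    by (auto simp: shortest_path_def is_path_iff is_walk_def)
qed

lemma single_fault_restoration:
  assumes st: "is_path V (E - {e}) s t p0"
  shows "\<exists>x\<in>V. \<exists>p q. shortest_path V E w s x p \<and> shortest_path V E w t x q \<and>
           unweighted_shortest_path V (E - {e}) s t (p @ tl (rev q))"
proof -
  obtain p where p: "unweighted_shortest_path V (E - {e}) s t p"
    using ex_shortest_path[OF finite_V st] by blast
  then have p_walk: "is_walk V (E - {e}) s t p"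
    by (simp add: shortest_path_def is_path_iff)
  then have p_walk': "is_walk V E s t p"
    by (auto simp: is_walk_def)
  \<comment> \<open>Any \<open>x\<close> on \<open>p\<close> will do once both halves avoid
    \<open>e\<close>: each has no more hops than the corresponding part of \<open>p\<close>, so
    together they are at most as long as \<open>p\<close>.\<close>
  have restore: "unweighted_shortest_path V (E - {e}) s t (p1 @ tl (rev p2))"
    if p1: "shortest_path V E w s x p1" "e \<notin> path_edges p1"
      and p2: "shortest_path V E w t x p2" "e \<notin> path_edges p2"
      and p_split: "p = xs @ x # ys" for x xs ys p1 p2
  proof (rule short_walk)
    have avoid: "is_walk V (E - {e}) s x p1" "is_walk V (E - {e}) x t (rev p2)"
      by (rule is_walk_avoid[OF is_walk_if_shortest[OF p1(1)] p1(2)],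
          rule is_walk_rev[OF is_walk_avoid[OF is_walk_if_shortest[OF p2(1)] p2(2)]])
    note conc = walk_concat[OF avoid]
    show "is_walk V (E - {e}) s t (p1 @ tl (rev p2))" by (rule conc)
    have parts: "is_walk V E s x (xs @ [x])" "is_walk V E x t (x # ys)"
      using p_walk' is_walk_join_iff[of V E s t xs x ys] by (simp_all add: p_split)
    have "hops p1 + hops p2 \<le> hops p"
      using path_weight_join[of "\<lambda>_. 1" xs x ys] 
        hops_le_walk[OF p1(1) parts(1)] hops_le_walk[OF p2(1) is_walk_rev[OF parts(2)]]
      by (simp add: hops_rev p_split del: rev.simps)
    then show "hops (p1 @ tl (rev p2)) \<le> hops q" if "is_path V (E - {e}) s t q" for q
      using that p conc(2) by (fastforce simp: shortest_path_def hops_rev)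
  qed
  \<comment> \<open>By \<open>unique\<close>, this is a property of the one shortest path from
    \<open>s\<close> to \<open>x\<close>. If \<open>t\<close> is good, then \<open>x = t\<close>
    works with the trivial path; otherwise goodness is lost along some edge of
    \<open>p\<close>.\<close>
  define good where "good x \<longleftrightarrow> (\<exists>p1. shortest_path V E w s x p1 \<and> e \<notin> path_edges p1)" for x
  show ?thesis
  proof (cases "good t")
    case True
    then obtain p1 where p1: "shortest_path V E w s t p1" "e \<notin> path_edges p1"
      by (auto simp: good_def)
    have t: "t \<in> V" "p = butlast p @ t # []"
      using p_walk by (auto simp: is_walk_def)
    with restore[OF p1 shortest_trivial _ t(2)] p1 shortest_trivial show ?thesis
      by fastforce
  next
    case False
    have "s \<in> V"
      using p_walk by (auto simp: is_walk_def)
    then have "good s"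
      using shortest_trivial by (force simp: good_def)
    then obtain xs x y ys where xy: "p = xs @ x # y # ys" "good x" "\<not> good y"
      using False list_first_failure[of p good] p_walk by (auto simp: is_walk_def)
    obtain p1 where p1: "shortest_path V E w s x p1" "e \<notin> path_edges p1"
      using xy(2) by (auto simp: good_def)
    have parts: "is_walk V (E - {e}) s x (xs @ [x])" "is_walk V (E - {e}) x t (x # y # ys)"
      "is_walk V (E - {e}) s y ((xs @ [x]) @ [y])" "is_walk V (E - {e}) y t (y # ys)"
      using p_walk xy(1) is_walk_join_iff[of V "E - {e}" s t xs x "y # ys"]
        is_walk_join_iff[of V "E - {e}" s t "xs @ [x]" y ys] by simp_all
    have parts': "is_walk V E s x (xs @ [x])" "is_walk V E x t (x # y # ys)"
      "is_walk V E s y ((xs @ [x]) @ [y])" "is_walk V E y t (y # ys)"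
      using parts by (auto simp: is_walk_def)
    have xyE: "{x, y} \<in> E" "{x, y} \<noteq> e" "x \<in> V" "y \<in> V"
      using parts(2) by (auto simp: is_walk_def)
    obtain p2 where p2: "shortest_path V E w t x p2"
      using ex_shortest is_walk_rev[OF parts'(2)] by blast
    obtain p3 where p3: "shortest_path V E w s y p3"
      using ex_shortest parts'(3) by blast
    \<comment> \<open>Only a term of comparison: it bounds the swapped walk from \<open>t\<close> to
      \<open>y\<close>, and extended by \<open>x\<close> it competes with \<open>p2\<close>.\<close>
    obtain p4 where p4: "shortest_path V E w t y p4"
      using ex_shortest is_walk_rev[OF parts'(4)] by blast
    note pw = p1(1)[THEN is_walk_if_shortest] p2[THEN is_walk_if_shortest]
      p3[THEN is_walk_if_shortest] p4[THEN is_walk_if_shortest]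
    have "e \<in> path_edges p3"
      using xy(3) p3 by (auto simp: good_def)
    then obtain A u v B where p3_eq: "p3 = A @ u # v # B" and e: "e = {u, v}"
      by (rule path_edge_cases)
    have p3_walks: "is_walk V E s u (A @ [u])" "is_walk V E v y (v # B)" "{u, v} \<in> E"
      using pw(3) is_walk_join_iff[of V E s y A u "v # B"]
        is_walk_join_iff[of V E u y "[u]" v B] unfolding p3_eq by (auto simp: is_walk_def)
    have p3_weight: "path_weight w' p3 = path_weight w' (A @ [u]) + w' (u, v) + path_weight w' (v # B)"
      for w' using path_weight_join[of w' A u "v # B"] by (simp add: p3_eq)
    have "e \<notin> path_edges p2"
    proof
      assume "e \<in> path_edges p2"
      then obtain C u' v' D where p2_eq: "p2 = C @ u' # v' # D" and e': "e = {u', v'}"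
        by (rule path_edge_cases)
      have p2_walks: "is_walk V E t u' (C @ [u'])" "is_walk V E v' x (v' # D)"
        using pw(2) is_walk_join_iff[of V E t x C u' "v' # D"]
          is_walk_join_iff[of V E u' x "[u']" v' D] unfolding p2_eq by (auto simp: is_walk_def)
      have p2_weight:
        "path_weight w' p2 = path_weight w' (C @ [u']) + w' (u', v') + path_weight w' (v' # D)"
        for w' using path_weight_join[of w' C u' "v' # D"] by (simp add: p2_eq)
      consider "u' = u" "v' = v" | "u' = v" "v' = u"
        using e e' by (auto simp: doubleton_eq_iff)
      then show False
      proof cases
        case 1
        text \<open>Both paths cross \<open>e\<close> from \<open>u\<close> to \<open>v\<close>, so going from \<open>s\<close> to \<open>u\<close> and back to \<open>t\<close>
          avoids \<open>e\<close> and is shorter than \<open>p\<close>.\<close>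
        have "v \<notin> set (A @ [u])" "v \<notin> set (C @ [u])"
          using p3 p2 1 unfolding p3_eq p2_eq by (auto simp: shortest_path_def is_path_iff)
        then have "e \<notin> path_edges (A @ [u])" "e \<notin> path_edges (C @ [u])"
          unfolding e path_edges_def using arcs_in_vwalk_arcs
          by (fastforce simp: doubleton_eq_iff)+
        then have "is_walk V (E - {e}) s u (A @ [u])" "is_walk V (E - {e}) u t (rev (C @ [u]))"
          using is_walk_avoid[OF p3_walks(1)] is_walk_rev[OF is_walk_avoid[OF p2_walks(1)]] 1
          by simp_all
        note conc = walk_concat[OF this]
        have "hops p \<le> hops (A @ [u]) + hops (C @ [u])"
          using unweighted_shortest_path_le_walk[OF p conc(1)] unfolding conc(2) hops_rev .
        moreover have "hops p3 \<le> hops ((xs @ [x]) @ [y])" "hops p2 \<le> hops (rev (x # y # ys))"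
          by (rule hops_le_walk[OF p3 parts'(3)], rule hops_le_walk[OF p2 is_walk_rev[OF parts'(2)]])
        \<comment> \<open>The edge \<open>{x, y}\<close> is counted twice. So \<open>p3\<close> and
          \<open>p2\<close> have at most \<open>hops p + 1\<close> hops together, while two passages
          over \<open>e\<close> force at least \<open>hops p + 2\<close>.\<close>
        moreover have "hops ((xs @ [x]) @ [y]) + hops (x # y # ys) = hops p + 1"
          using path_weight_join[of "\<lambda>_. 1" xs x "y # ys"] path_weight_snoc[of "xs @ [x]" "\<lambda>_. 1" y] xy(1)
          by simp
        moreover have "hops (v # B) \<ge> 0" "hops (v # D) \<ge> 0"
          by (simp_all add: hops_eq)
        ultimately show False
          using p3_weight[of "\<lambda>_. 1"] p2_weight[of "\<lambda>_. 1"] 1 by (simp only: hops_rev)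
      next
        case 2
        text \<open>The paths cross \<open>e\<close> in opposite directions. Swapping their tails after \<open>e\<close> trades
          both arcs of \<open>e\<close> for both arcs of \<open>{x, y}\<close>, and each pair of arcs weighs 2.\<close>
        have sx: "is_walk V E s x (A @ u # D)" and ty: "is_walk V E t y (C @ v # B)"
          using p3_walks p2_walks 2 is_walk_join_iff[of V E s x A u D] is_walk_join_iff[of V E t y C v B]
          by simp_all
        have last: "last p1 = x" "last p4 = y" "p1 \<noteq> []" "p4 \<noteq> []"
          using pw by (auto simp: is_walk_def)
        have sy: "is_walk V E s y (p1 @ [y])" and tx: "is_walk V E t x (p4 @ [x])"
          using pw last xyE by (auto simp: is_walk_snoc_iff insert_commute)
        have ext: "path_weight w' (p1 @ [y]) = path_weight w' p1 + w' (x, y)"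
          "path_weight w' (p4 @ [x]) = path_weight w' p4 + w' (y, x)" for w'
          using last by (simp_all add: path_weight_snoc)
        have swap: "path_weight w' (A @ u # D) + path_weight w' (C @ v # B) + w' (u, v) + w' (v, u)
            = path_weight w' p3 + path_weight w' p2" for w'
          using path_weight_join[of w' A u D] path_weight_join[of w' C v B]
            p3_weight[of w'] p2_weight[of w'] 2 by simp
        have h: "hops p1 \<le> hops (A @ u # D)" "hops p4 \<le> hops (C @ v # B)"
          "hops p3 \<le> hops (p1 @ [y])" "hops p2 \<le> hops (p4 @ [x])"
          by (rule hops_le_walk[OF p1(1) sx] hops_le_walk[OF p4 ty] hops_le_walk[OF p3 sy]
              hops_le_walk[OF p2 tx])+
        \<comment> \<open>With \<open>swap\<close> and \<open>ext\<close> the four inequalities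
          close up into a cycle, so all of them are equalities. All four walks now qualify for
          \<open>weight_le_walk\<close>.\<close>
        then have h': "hops (A @ u # D) \<le> hops p1" "hops (C @ v # B) \<le> hops p4"
          "hops (p1 @ [y]) \<le> hops p3" "hops (p4 @ [x]) \<le> hops p2"
          using swap[of "\<lambda>_. 1"] ext[of "\<lambda>_. 1"] by linarith+
        have "path_weight w p1 \<le> path_weight w (A @ u # D)"
          "path_weight w p4 \<le> path_weight w (C @ v # B)"
          "path_weight w p2 \<le> path_weight w (p4 @ [x])"
          by (rule weight_le_walk(1)[OF p1(1) sx h'(1)] weight_le_walk(1)[OF p4 ty h'(2)]
              weight_le_walk(1)[OF p2 tx h'(4)])+
        moreover have "w (u, v) + w (v, u) = 2" "w (x, y) + w (y, x) = 2"
          using both_directions p3_walks(3) xyE(1) by auto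
        \<comment> \<open>The same cycle in terms of \<open>w\<close>: three inequalities force the
          reverse of the fourth. Here the two arcs of \<open>e\<close> and the two arcs of
          \<open>{x, y}\<close> cancel.\<close>
        ultimately have "path_weight w (p1 @ [y]) \<le> path_weight w p3"
          using swap[of w] ext[of w] by linarith
        then have "p1 @ [y] = p3"
          using weight_le_walk(2)[OF p3 sy h'(3)] by blast
        then show False
          using \<open>e \<in> path_edges p3\<close> p1(2) xyE(2) last path_edges_snoc[of p1 y] by auto
      qed
    qed
    then show ?thesis
      using restore[OF p1 p2 _ xy(1)] p1 p2 xyE(3) by blast
  qed
qed

end


section \<open>Schemes selected by a tiebreaking weight\<close>

text \<open>Keeps the claim about all selected schemes from being vacuous.\<close>

lemma ex_selected:
  assumes "\<And>F. F \<subseteq> E \<Longrightarrow> tiebreaking_weight V (E - F) w"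
  shows "\<exists>\<pi>. selected_by V E w \<pi>"
proof -
  define \<pi> where "\<pi> s t F = (if \<exists>p. is_path V (E - F) s t p
      then Some (SOME p. shortest_path V (E - F) w s t p) else None)" for s t F
  have some: "shortest_path V (E - F) w s t (SOME p. shortest_path V (E - F) w s t p)"
    if "F \<subseteq> E" "is_path V (E - F) s t p" for s t F p
    by (rule someI_ex) (rule tiebreaking_weight.ex_shortest[OF assms[OF that(1)] is_pathD(1)[OF that(2)]])
  then have "selected_by V E w \<pi>"
    unfolding selected_by_def \<pi>_def by (auto intro: tiebreaking_weight.unique[OF assms _ some])
  then show ?thesis by blast
qed

locale selected_scheme =
  fixes V :: "'a set" and E :: "'a set set" and w :: "'a \<times> 'a \<Rightarrow> real" and \<pi> :: "'a scheme"
  assumes tiebreaking: "F \<subseteq> E \<Longrightarrow> tiebreaking_weight V (E - F) w"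
    and selected: "selected_by V E w \<pi>"
begin

lemma scheme_cases:
  assumes "F \<subseteq> E" "s \<in> V" "t \<in> V"
  obtains (None) "\<pi> s t F = None" "\<nexists>p. is_path V (E - F) s t p"
  | (Some) p where "\<pi> s t F = Some p" "shortest_path V (E - F) w s t p"
proof -
  have "case \<pi> s t F of None \<Rightarrow> \<nexists>p. is_path V (E - F) s t p | Some p \<Rightarrow> shortest_path V (E - F) w s t p"
    using selected[unfolded selected_by_def, rule_format, OF assms] by (simp split: option.splits)
  then show thesis
    using that by (cases "\<pi> s t F") simp_all
qed

text \<open>Uniqueness lets statements about the scheme be replaced by statements about
  \<open>shortest_path\<close>.\<close>

lemma scheme_eq_Some_iff:
  assumes "F \<subseteq> E" "s \<in> V" "t \<in> V"
  shows "\<pi> s t F = Some p \<longleftrightarrow> shortest_path V (E - F) w s t p"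
  using assms
proof (cases rule: scheme_cases)
  case None
  then show ?thesis by (simp add: shortest_path_def)
next
  case (Some q)
  then show ?thesis
    using tiebreaking_weight.unique[OF tiebreaking[OF assms(1)]] by auto
qed

lemma rpts: "rpts V E \<pi>"
  unfolding rpts_def tiebreaking_scheme_def
proof (intro allI ballI impI)
  fix F s t assume F: "F \<subseteq> E" "s \<in> V" "t \<in> V"
  then show "case \<pi> s t F of None \<Rightarrow> \<nexists>p. is_path V (E - F) s t p
      | Some p \<Rightarrow> unweighted_shortest_path V (E - F) s t p"
    by (cases rule: scheme_cases) (simp_all add: tiebreaking_weight.refines[OF tiebreaking[OF F(1)]])
qed

text \<open>Deleting \<open>f\<close> only removes competitors and keeps the selected path, which
  therefore stays optimal. If there was no path, deletion creates none.\<close>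

lemma stable: "stable V E \<pi>"
  unfolding stable_def
proof (intro allI ballI impI)
  fix F s t f
  assume F: "F \<subseteq> E" "s \<in> V" "t \<in> V" "f \<in> E"
    and f: "\<forall>p. \<pi> s t F = Some p \<longrightarrow> f \<notin> path_edges p"
  have F': "F \<union> {f} \<subseteq> E" and diff: "E - (F \<union> {f}) = E - F - {f}"
    using F by auto
  have mono: "is_path V (E - F) s t q" if "is_path V (E - F - {f}) s t q" for q
    using is_path_mono[OF that] by blast
  show "\<pi> s t F = \<pi> s t (F \<union> {f})"
    using F(1-3)
  proof (cases rule: scheme_cases)
    case None
    have "\<nexists>p. is_path V (E - (F \<union> {f})) s t p"
      unfolding diff using None(2) mono by blast
    then have "\<pi> s t (F \<union> {f}) = None"
      using scheme_cases[OF F' F(2,3)] by (metis shortest_path_def)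
    with None show ?thesis by simp
  next
    case (Some p)
    have "is_path V (E - F - {f}) s t p"
      using Some f by (intro is_path_avoid) (simp_all add: shortest_path_def)
    then have "shortest_path V (E - (F \<union> {f})) w s t p"
      unfolding diff using Some(2) mono by (simp add: shortest_path_def)
    then show ?thesis
      using Some(1) scheme_eq_Some_iff[OF F' F(2,3)] by (metis (no_types))
  qed
qed

lemma consistent: "consistent V E \<pi>"
  unfolding consistent_def
proof (intro allI ballI impI)
  fix F s t u v p
  assume F: "F \<subseteq> E" "s \<in> V" "t \<in> V" "u \<in> V" "v \<in> V"
    and p: "\<pi> s t F = Some p \<and> precedes u v p"
  then obtain i j where ij: "i < j" "j < length p" "p ! i = u" "p ! j = v"
    by (auto simp: precedes_def)
  \<comment> \<open>The vertices strictly between positions \<open>i\<close> and \<open>j\<close>,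
    possibly none.\<close>
  define ys where "ys = take (j - Suc i) (drop (Suc i) p)"
  have "drop (Suc i) p = ys @ v # drop (Suc j) p"
    using id_take_nth_drop[of "j - Suc i" "drop (Suc i) p"] ij by (simp add: ys_def)
  then have p_eq: "p = take i p @ u # ys @ v # drop (Suc j) p"
    using id_take_nth_drop[of i p] ij by simp
  have "shortest_path V (E - F) w s t (take i p @ u # ys @ v # drop (Suc j) p)"
    using p p_eq scheme_eq_Some_iff[OF F(1-3)] by simp
  then have "shortest_path V (E - F) w u v (u # ys @ [v])"
    by (rule tiebreaking_weight.shortest_subpath[OF tiebreaking[OF F(1)]])
  then have "\<pi> u v F = Some (u # ys @ [v])"
    using scheme_eq_Some_iff[OF F(1,4,5)] by simp
  moreover have "p = take i p @ (u # ys @ [v]) @ drop (Suc j) p"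
    using p_eq by simp
  then have "sublist (u # ys @ [v]) p"
    unfolding sublist_def by blast
  ultimately show "\<exists>q. \<pi> u v F = Some q \<and> sublist q p"
    by blast
qed

text \<open>Failing \<open>F\<close> amounts to failing a single edge \<open>e \<in> F\<close> in the graph without \<open>F - {e}\<close>.\<close>

lemma restorable: "restorable V E \<pi>"
  unfolding restorable_def
proof (intro ballI allI impI)
  fix s t F
  assume st: "s \<in> V" "t \<in> V" and F: "F \<subseteq> E" "F \<noteq> {} \<and> (\<exists>p. is_path V (E - F) s t p)"
  then obtain e p where e: "e \<in> F" and p: "is_path V (E - F) s t p"
    by blast
  let ?F' = "F - {e}"
  have F': "?F' \<subseteq> E" "?F' \<subset> F" and diff: "E - F = E - ?F' - {e}"
    using F e by auto
  obtain x p q where x: "x \<in> V" and "shortest_path V (E - ?F') w s x p"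
      "shortest_path V (E - ?F') w t x q"
    and pq: "unweighted_shortest_path V (E - F) s t (p @ tl (rev q))"
    using tiebreaking_weight.single_fault_restoration[OF tiebreaking[OF F'(1)]] p
    unfolding diff by blast
  then have "\<pi> s x ?F' = Some p" "\<pi> t x ?F' = Some q"
    using scheme_eq_Some_iff[OF F'(1)] st by auto
  then show "\<exists>x\<in>V. \<exists>F'. F' \<subset> F \<and> (\<exists>p q. \<pi> s x F' = Some p \<and> \<pi> t x F' = Some q \<and>
      unweighted_shortest_path V (E - F) s t (p @ tl (rev q)))"
    using x F'(2) pq by blast
qed

end


section \<open>Almost sure uniqueness of shortest paths\<close>

lemma in_vwalk_arcs_nthE:
  assumes "(u, v) \<in> set (vwalk_arcs p)"
  obtains i where "Suc i < length p" "p ! i = u" "p ! Suc i = v"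
proof -
  obtain xs ys where "p = xs @ u # v # ys"
    using in_vwalk_arcsD[OF assms] by blast
  then show thesis
    by (intro that[of "length xs"]) (simp_all add: nth_append)
qed

text \<open>The edge is the one that \<open>p\<close> takes right after the longest common prefix of
  \<open>p\<close> and \<open>q\<close>.\<close>

lemma paths_diverge:
  assumes p: "is_path V E s t p" and q: "is_path V E s t q" and "p \<noteq> q"
  shows "\<exists>u v. (u, v) \<in> set (vwalk_arcs p) \<and> (v, u) \<notin> set (vwalk_arcs p) \<and>
           (u, v) \<notin> set (vwalk_arcs q) \<and> (v, u) \<notin> set (vwalk_arcs q)"
proof -
  \<comment> \<open>A proper extension of \<open>a\<close> would end in \<open>t\<close> a second
    time, against distinctness.\<close>
  have prefix_eq: "a = b" if ab: "prefix a b" "is_path V E s t a" "is_path V E s t b" for a b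
  proof -
    obtain z where "b = a @ z"
      using ab(1) by (auto simp: prefix_def)
    then show ?thesis
      using ab(2,3) unfolding is_path_iff is_walk_def by (cases z rule: rev_cases) auto
  qed
  have "p \<parallel> q"
    using prefix_eq[OF _ p q] prefix_eq[OF _ q p] \<open>p \<noteq> q\<close> by (intro parallelI) auto
  then obtain as v bs v' cs where as: "v \<noteq> v'" "p = as @ v # bs" "q = as @ v' # cs"
    using parallel_decomp by blast
  have "as \<noteq> []"
    using as is_pathD(1)[OF p] is_pathD(1)[OF q] by (auto simp: is_walk_def)
  then obtain as' u where "as = as' @ [u]"
    by (cases as rule: rev_cases) auto
  then have p_eq: "p = as' @ u # v # bs" and q_eq: "q = as' @ u # v' # cs"
    using as by auto
  let ?n = "length as'"
  have nth: "p ! ?n = u" "p ! Suc ?n = v" "q ! ?n = u" "q ! Suc ?n = v'"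
    "\<And>i. i < ?n \<Longrightarrow> q ! i = p ! i"
    by (simp_all add: p_eq q_eq nth_append)
  have len: "Suc ?n < length p" "Suc ?n < length q"
    by (simp_all add: p_eq q_eq)
  have index_eq: "i = j" if "distinct xs" "i < length xs" "j < length xs" "xs ! i = xs ! j"
    for i j and xs :: "'a list"
    using that nth_eq_iff_index_eq by blast
  have idx: "distinct p" "distinct q"
    by (fact is_pathD(2)[OF p] is_pathD(2)[OF q])+
  have "(u, v) \<in> set (vwalk_arcs p)"
    unfolding p_eq vwalk_arcs_join[of as' u "v # bs"] by simp
  moreover have "(v, u) \<notin> set (vwalk_arcs p)"
  proof
    assume "(v, u) \<in> set (vwalk_arcs p)"
    then obtain i where i: "Suc i < length p" "p ! i = v" "p ! Suc i = u"
      by (rule in_vwalk_arcs_nthE)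
    have "i = Suc ?n"
      by (rule index_eq[OF idx(1) _ len(1)]) (simp_all only: i nth Suc_lessD[OF i(1)])
    moreover have "Suc i = ?n"
      by (rule index_eq[OF idx(1) i(1) Suc_lessD[OF len(1)]]) (simp only: i nth)
    ultimately show False by simp
  qed
  moreover have "(u, v) \<notin> set (vwalk_arcs q)"
  proof
    assume "(u, v) \<in> set (vwalk_arcs q)"
    then obtain i where i: "Suc i < length q" "q ! i = u" "q ! Suc i = v"
      by (rule in_vwalk_arcs_nthE)
    have "i = ?n"
      by (rule index_eq[OF idx(2) Suc_lessD[OF i(1)] Suc_lessD[OF len(2)]]) (simp only: i nth)
    then show False
      using i(3) nth(4) as(1) by simp
  qed
  moreover have "(v, u) \<notin> set (vwalk_arcs q)"
  proof
    assume "(v, u) \<in> set (vwalk_arcs q)"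
    then obtain i where i: "Suc i < length q" "q ! i = v" "q ! Suc i = u"
      by (rule in_vwalk_arcs_nthE)
    have n: "Suc i = ?n"
      by (rule index_eq[OF idx(2) i(1) Suc_lessD[OF len(2)]]) (simp only: i nth)
    \<comment> \<open>The arc \<open>(v, u)\<close> on \<open>q\<close> would put \<open>v\<close>
      into the common prefix, hence on \<open>p\<close> twice.\<close>
    have "i = Suc ?n"
    proof (rule index_eq[OF idx(1) _ len(1)])
      show "i < length p" using n len(1) by linarith
      have "p ! i = q ! i" using nth(5)[of i] n by simp
      then show "p ! i = p ! Suc ?n" by (simp only: i nth)
    qed
    then show False
      using n by simp
  qed
  ultimately show ?thesis by blast
qed

text \<open>The net flow of \<open>p\<close> across \<open>a\<close>. It is the coefficient of the
  perturbation of \<open>a\<close> in the reweighted length, because the reverse arc carries the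
  negated perturbation.\<close>

definition net_count :: "'a list \<Rightarrow> 'a \<times> 'a \<Rightarrow> real" where
  "net_count p a = real (count_list (vwalk_arcs p) a) - real (count_list (vwalk_arcs p) (prod.swap a))"

text \<open>Collecting both arcs of each edge on its representative in \<open>D\<close> gives a
  linear form in the perturbations that are drawn independently.\<close>

lemma path_weight_reweight:
  assumes D: "finite D" "orientation E D" and \<rho>: "antisymmetric_on E \<rho>" and p: "path_edges p \<subseteq> E"
  shows "path_weight (reweight \<rho>) p = hops p + (\<Sum>a\<in>D. net_count p a * \<rho> a)"
  using p
proof (induction p rule: vwalk_arcs.induct)
  case (3 x y xs)
  then have E: "{x, y} \<in> E" "{y, x} \<in> E" and IH: "path_edges (y # xs) \<subseteq> E"
    by (auto simp: insert_commute)
  \<comment> \<open>For \<open>x = y\<close> this equivalence is contradictory, so an orientation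
    excludes loops.\<close>
  have xy: "(x, y) \<in> D \<longleftrightarrow> (y, x) \<notin> D"
    using D(2) E(1) unfolding orientation_def by blast
  then have "x \<noteq> y" by blast
  have net: "net_count (x # y # xs) a * \<rho> a = net_count (y # xs) a * \<rho> a
      + ((if a = (x, y) then \<rho> a else 0) - (if a = (y, x) then \<rho> a else 0))" for a
    using \<open>x \<noteq> y\<close> by (cases a) (auto simp: net_count_def algebra_simps)
  have "\<rho> (y, x) = - \<rho> (x, y)"
    using \<rho> E(1) by (simp add: antisymmetric_on_def)
  then have delta: "(\<Sum>a\<in>D. (if a = (x, y) then \<rho> a else 0) - (if a = (y, x) then \<rho> a else 0)) = \<rho> (x, y)"
    unfolding sum_subtractf sum.delta[OF D(1)] using xy by (cases "(x, y) \<in> D") simp_all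
  have "(\<Sum>a\<in>D. net_count (x # y # xs) a * \<rho> a)
      = (\<Sum>a\<in>D. net_count (y # xs) a * \<rho> a) + \<rho> (x, y)"
    unfolding net sum.distrib delta ..
  then show ?case
    using "3.IH"[OF IH] by (simp add: reweight_def)
qed (simp_all add: path_weight_def net_count_def)

text \<open>At the diverging edge \<open>p\<close> crosses in one direction only and
  \<open>q\<close> not at all, so the counts differ at whichever of its two arcs lies in
  \<open>D\<close>.\<close>

lemma paths_net_count_differ:
  assumes "orientation E D" "is_path V E s t p" "is_path V E s t q" "p \<noteq> q"
  shows "\<exists>a\<in>D. net_count p a \<noteq> net_count q a"
proof -
  obtain u v where uv: "(u, v) \<in> set (vwalk_arcs p)" "(v, u) \<notin> set (vwalk_arcs p)"
      "(u, v) \<notin> set (vwalk_arcs q)" "(v, u) \<notin> set (vwalk_arcs q)"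
    using paths_diverge[OF assms(2-4)] by blast
  then have "{u, v} \<in> path_edges p"
    by (force simp: path_edges_def)
  then have "{u, v} \<in> E"
    using assms(2) by (auto simp: is_path_iff is_walk_def)
  then have "(u, v) \<in> D \<or> (v, u) \<in> D"
    using assms(1) by (auto simp: orientation_def)
  moreover have "net_count p (u, v) \<noteq> net_count q (u, v)" "net_count p (v, u) \<noteq> net_count q (v, u)"
    using uv count_list_0_iff by (fastforce simp: net_count_def)+
  ultimately show ?thesis by blast
qed

section \<open>Independent sums that almost surely miss a given value\<close>

context prob_space
begin

text \<open>Fubini: the joint law is a product, and for fixed \<open>y\<close> only the single value
  \<open>k - y\<close> of \<open>X\<close> is excluded, which is a null event.\<close>

lemma AE_indep_sum_neq:
  fixes X Y :: "'a \<Rightarrow> real"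
  assumes indep: "indep_var borel X borel Y" and atomless: "\<And>y. AE \<omega> in M. X \<omega> \<noteq> y"
  shows "AE \<omega> in M. X \<omega> + Y \<omega> \<noteq> k"
proof -
  have [measurable]: "X \<in> borel_measurable M" "Y \<in> borel_measurable M"
    using indep indep_var_rv1 indep_var_rv2 by blast+
  interpret X: prob_space "distr M borel X" by (rule prob_space_distr) simp
  interpret Y: prob_space "distr M borel Y" by (rule prob_space_distr) simp
  interpret XY: pair_sigma_finite "distr M borel X" "distr M borel Y" ..
  have joint: "distr M borel X \<Otimes>\<^sub>M distr M borel Y
      = distr M (borel \<Otimes>\<^sub>M borel) (\<lambda>\<omega>. (X \<omega>, Y \<omega>))"
    using indep by (simp add: indep_var_distribution_eq)
  have "open {z :: real \<times> real. fst z + snd z \<noteq> k}"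
    by (intro open_Collect_neq continuous_intros)
  then have sum_neq: "{z :: real \<times> real. fst z + snd z \<noteq> k} \<in> sets (borel \<Otimes>\<^sub>M borel)"
    by (subst borel_prod) (rule borel_open)
  have "AE x in distr M borel X. x + y \<noteq> k" for y
    using atomless[of "k - y"] by (subst AE_distr_iff) (auto simp: algebra_simps)
  then have "AE y in distr M borel Y. AE x in distr M borel X. x + y \<noteq> k"
    by simp
  \<comment> \<open>The null sets are known for fixed \<open>y\<close>, whereas
    \<open>AE_pair_measure\<close> wants the first coordinate outermost.\<close>
  then have "AE x in distr M borel X. AE y in distr M borel Y. x + y \<noteq> k"
    using sum_neq by (subst XY.AE_commute) (simp_all add: space_pair_measure)
  then have "AE z in distr M borel X \<Otimes>\<^sub>M distr M borel Y. fst z + snd z \<noteq> k"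
    using sum_neq by (intro XY.AE_pair_measure) (simp_all add: space_pair_measure)
  then show ?thesis
    unfolding joint by (subst (asm) AE_distr_iff) auto
qed

text \<open>The term of \<open>i\<close> is split off: scaled by a nonzero factor it stays atomless,
  and it is independent of the remaining sum.\<close>

lemma AE_linear_combination_neq:
  fixes X :: "'i \<Rightarrow> 'a \<Rightarrow> real"
  assumes I: "finite I" "i \<in> I" "c i \<noteq> 0"
    and indep: "indep_vars (\<lambda>_. borel) X I" and atomless: "\<And>y. AE \<omega> in M. X i \<omega> \<noteq> y"
  shows "AE \<omega> in M. (\<Sum>i\<in>I. c i * X i \<omega>) \<noteq> k"
proof -
  have "indep_vars (\<lambda>_. borel) (\<lambda>i \<omega>. c i * X i \<omega>) (insert i (I - {i}))"
    using indep_vars_compose2[OF indep, of "\<lambda>i x. c i * x" "\<lambda>_. borel"] I(2)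
    by (simp add: insert_absorb)
  then have "indep_var borel (\<lambda>\<omega>. c i * X i \<omega>) borel (\<lambda>\<omega>. \<Sum>i\<in>I - {i}. c i * X i \<omega>)"
    using I(1) by (intro indep_vars_sum) auto
  moreover have "AE \<omega> in M. c i * X i \<omega> \<noteq> y" for y
    using atomless[of "y / c i"] I(3) by (auto simp: field_simps)
  ultimately have "AE \<omega> in M. c i * X i \<omega> + (\<Sum>i\<in>I - {i}. c i * X i \<omega>) \<noteq> k"
    by (rule AE_indep_sum_neq)
  then show ?thesis
    using I by (simp add: sum.remove)
qed

end

text \<open>One null set serves all \<open>F\<close> and all endpoints: a path that survives a
  deletion is a path of the whole graph, and there are finitely many pairs of those.\<close>

lemma AE_tiebreaking_weight:
  assumes G: "undirected_graph V E" and small: "small_perturbation V E \<epsilon>"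
    and r: "antisymmetric_random_perturbation E \<epsilon> M r"
  shows "AE \<omega> in M. \<forall>F\<subseteq>E. tiebreaking_weight V (E - F) (reweight (r \<omega>))"
proof -
  interpret prob_space M
    using r by (simp add: antisymmetric_random_perturbation_def)
  obtain D where D: "orientation E D" and indep: "indep_vars (\<lambda>_. borel) (\<lambda>a \<omega>. r \<omega> a) D"
    and uniform: "\<And>a. a \<in> D \<Longrightarrow> distributed M lborel (\<lambda>\<omega>. r \<omega> a)
                  (\<lambda>x. indicator {-\<epsilon>..\<epsilon>} x / measure lborel {-\<epsilon>..\<epsilon>})"
    using r unfolding antisymmetric_random_perturbation_def by blast
  have V: "finite V"
    using G by (simp add: undirected_graph_def)
  have "D \<subseteq> V \<times> V"
  proof (rule subrelI)
    fix u v assume "(u, v) \<in> D"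
    then have "{u, v} \<in> E"
      using D by (auto simp: orientation_def)
    then show "(u, v) \<in> V \<times> V"
      using G by (fastforce simp: undirected_graph_def doubleton_eq_iff)
  qed
  then have "finite D"
    using V finite_subset by blast
  have atomless: "AE \<omega> in M. r \<omega> a \<noteq> y" if "a \<in> D" for a y
    using AE_lborel_singleton[of y] by (subst distributed_AE2[OF uniform[OF that]]) auto
  \<comment> \<open>The range of the perturbation is known only through its density, so
    \<open>small_perturbation\<close> applies almost surely rather than everywhere.\<close>
  have "AE \<omega> in M. \<bar>r \<omega> a\<bar> \<le> \<epsilon>" if "a \<in> D" for a
    by (subst distributed_AE2[OF uniform[OF that]]) (auto simp: indicator_def split: if_splits)
  then have bound: "AE \<omega> in M. \<forall>a\<in>D. \<bar>r \<omega> a\<bar> \<le> \<epsilon>"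
    using \<open>finite D\<close> by (intro AE_finite_allI)
  let ?P = "{p. set p \<subseteq> V \<and> distinct p}"
  have "AE \<omega> in M. \<forall>p\<in>?P. \<forall>q\<in>?P. (\<exists>a\<in>D. net_count p a \<noteq> net_count q a) \<longrightarrow>
      (\<Sum>a\<in>D. (net_count p a - net_count q a) * r \<omega> a) \<noteq> hops q - hops p"
  proof (intro AE_finite_allI finite_subset_distinct V)
    fix p q :: "'a list"
    show "AE \<omega> in M. (\<exists>a\<in>D. net_count p a \<noteq> net_count q a) \<longrightarrow>
      (\<Sum>a\<in>D. (net_count p a - net_count q a) * r \<omega> a) \<noteq> hops q - hops p"
    proof (cases "\<exists>a\<in>D. net_count p a \<noteq> net_count q a")
      case True
      then obtain a where a: "a \<in> D" "net_count p a - net_count q a \<noteq> 0" by auto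
      then show ?thesis
        using AE_linear_combination_neq[where c = "\<lambda>a. net_count p a - net_count q a",
            OF \<open>finite D\<close> a indep atomless[OF a(1)]] by simp
    qed simp
  qed
  with bound AE_space show ?thesis
  proof eventually_elim
    case (elim \<omega>)
    have anti: "antisymmetric_on E (r \<omega>)"
      using r elim(2) by (simp add: antisymmetric_random_perturbation_def)
    have bound: "\<bar>r \<omega> (u, v)\<bar> \<le> \<epsilon>" if "{u, v} \<in> E" for u v
    proof (cases "(u, v) \<in> D")
      case False
      then have "(v, u) \<in> D"
        using D that by (auto simp: orientation_def)
      then show ?thesis
        using elim(1) anti that by (auto simp: antisymmetric_on_def)
    qed (use elim(1) in auto)
    show ?case
    proof (intro allI impI)
      fix F assume F: "F \<subseteq> E"
      show "tiebreaking_weight V (E - F) (reweight (r \<omega>))"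
      proof
        show "finite V" by (rule V)
        show "reweight (r \<omega>) (u, v) + reweight (r \<omega>) (v, u) = 2" if "{u, v} \<in> E - F" for u v
          using anti that by (auto simp: reweight_def antisymmetric_on_def)
        show "unweighted_shortest_path V (E - F) s t p"
          if "shortest_path V (E - F) (reweight (r \<omega>)) s t p" for s t p
          using small anti bound F that unfolding small_perturbation_def by blast
        show "p = q" if pq: "shortest_path V (E - F) (reweight (r \<omega>)) s t p"
          "shortest_path V (E - F) (reweight (r \<omega>)) s t q" for s t p q
        proof (rule ccontr)
          assume "p \<noteq> q"
          have paths: "is_path V E s t p" "is_path V E s t q"
            using pq is_path_mono[of V "E - F" s t _ E] by (auto simp: shortest_path_def)
          then have edges: "path_edges p \<subseteq> E" "path_edges q \<subseteq> E" and "p \<in> ?P" "q \<in> ?P"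
            by (auto simp: is_path_iff is_walk_def)
          \<comment> \<open>Equal weights of \<open>p\<close> and \<open>q\<close> would give
            exactly this equality, by \<open>path_weight_reweight\<close>.\<close>
          then have "(\<Sum>a\<in>D. (net_count p a - net_count q a) * r \<omega> a) \<noteq> hops q - hops p"
            using elim(3) paths_net_count_differ[OF D paths \<open>p \<noteq> q\<close>] by blast
          moreover have "path_weight (reweight (r \<omega>)) p = path_weight (reweight (r \<omega>)) q"
            using pq by (simp add: shortest_path_def order_antisym)
          ultimately show False
            using path_weight_reweight[OF \<open>finite D\<close> D anti edges(1)]
              path_weight_reweight[OF \<open>finite D\<close> D anti edges(2)]
            by (simp add: left_diff_distrib sum_subtractf)
        qed
      qed
    qed
  qed
qed

theorem theorem21:
  fixes V :: "'a set" and E :: "'a set set" and \<epsilon> :: real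
    and M :: "'w measure" and r :: "'w \<Rightarrow> 'a \<times> 'a \<Rightarrow> real"
  assumes "undirected_graph V E"
    and "\<epsilon> > 0"
    and "small_perturbation V E \<epsilon>"
    and "antisymmetric_random_perturbation E \<epsilon> M r"
  shows "AE \<omega> in M.
           (\<exists>\<pi>. selected_by V E (reweight (r \<omega>)) \<pi>) \<and>
           (\<forall>\<pi>. selected_by V E (reweight (r \<omega>)) \<pi> \<longrightarrow>
                rpts V E \<pi> \<and> stable V E \<pi> \<and> consistent V E \<pi> \<and> restorable V E \<pi>)"
  using AE_tiebreaking_weight[OF assms(1,3,4)]
proof eventually_elim
  case (elim \<omega>)
  then have "selected_scheme V E (reweight (r \<omega>)) \<pi>" if "selected_by V E (reweight (r \<omega>)) \<pi>" for \<pi>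
    using that by (simp add: selected_scheme_def)
  then show ?case
    using ex_selected elim selected_scheme.rpts selected_scheme.stable selected_scheme.consistent
      selected_scheme.restorable by metis
qed

end
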